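(* (i) There is $A\in\mathrm{ClForm}$ with $\not\models^V_{S_\infty}A\lor\neg A$. (ii) There are $A,B\in\mathrm{ClForm}$ such that $\models^V_{S_\infty}B\to A$ and $\models^V_{S_\infty}B$, but $\not\models^V_{S_\infty}A$.
   Context: $\mathrm{NDE}$ is the set of closed terms generated from $\overline 0$ by a unary symbol $S$ and binary symbols $+$, $\cdot$; for $z\in\mathrm{NDE}$, $[\![z]\!]\in\mathbb N$ is the number it denotes under the standard interpretation. $\mathrm{Eq}=\{x=y: x,y\in\mathrm{NDE}\}$ is the set of formal equations. $\mathrm{ClForm}$ is generated from $\bot$ and $\mathrm{Eq}$ by $\land,\lor,\to$; $\neg A$ abbreviates $A\to\bot$. $S_\infty=\langle T,\le_T,M,E\rangle$ is the following rooted, finitely branching tree, all of whose branches are $\omega$-sequences, with $M:T\to\mathcal P(\mathrm{NDE})$ and $E:T\to\mathcal P(\mathrm{Eq})$. The root $t_0$ has $M(t_0)=\{\overline 0\}$, $E(t_0)=\emptyset$. The direct successors of a node $t$ are the following, for all $x,y\in M(t)$: (1) for $z$ each of $S(x)$, $x+y$, $x\cdot y$ with $z\notin M(t)$, a direct successor $t'$ with $M(t')=M(t)\cup\{z\}$, $E(t')=E(t)$; (2) if $[\![x]\!]=[\![y]\!]$ and $(x=y)\notin E(t)$, a direct successor $t'$ with $M(t')=M(t)$, $E(t')=E(t)\cup\{x=y\}$. Forcing: $t\models p$ iff $p\in E(t)$ for $p\in\mathrm{Eq}$; $t\not\models\bot$; $t\models A\land B$ iff $t\models A$ and $t\models B$;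 $t\models A\lor B$ iff $t\models A$ or $t\models B$; $t\models A\to B$ iff for every $t'\ge_T t$ with $t'\models A$ there is $t''\ge_T t'$ with $t''\models B$. $\models^V_{S_\infty}A$ (valid): $t\models A$ for all $t\in T$. *)

theory Defs
  imports "HOL-Library.Sublist"
begin

datatype nde = Zero | Succ nde | Plus nde nde | Times nde nde

primrec denote :: "nde \<Rightarrow> nat" where
  "denote Zero = 0"
| "denote (Succ x) = Suc (denote x)"
| "denote (Plus x y) = denote x + denote y"
| "denote (Times x y) = denote x * denote y"

datatype eqn = Eqn nde nde

datatype clform =
    Bot
  | Atom eqn
  | Conj clform clform
  | Disj clform clform
  | Imp clform clform

abbreviation Neg :: "clform \<Rightarrow> clform" where
  "Neg A \<equiv> Imp A Bot"

record 'n tree_structure =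
  nodes :: "'n set"
  le :: "'n \<Rightarrow> 'n \<Rightarrow> bool"
  M :: "'n \<Rightarrow> nde set"
  E :: "'n \<Rightarrow> eqn set"

primrec forces :: "'n tree_structure \<Rightarrow> 'n \<Rightarrow> clform \<Rightarrow> bool" where
  "forces K t Bot \<longleftrightarrow> False"
| "forces K t (Atom p) \<longleftrightarrow> p \<in> E K t"
| "forces K t (Conj A B) \<longleftrightarrow> forces K t A \<and> forces K t B"
| "forces K t (Disj A B) \<longleftrightarrow> forces K t A \<or> forces K t B"
| "forces K t (Imp A B) \<longleftrightarrow>
     (\<forall>t' \<in> nodes K. le K t t' \<and> forces K t' A \<longrightarrow>
        (\<exists>t'' \<in> nodes K. le K t' t'' \<and> forces K t'' B))"

definition valid :: "'n tree_structure \<Rightarrow> clform \<Rightarrow> bool" where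
  "valid K A \<longleftrightarrow> (\<forall>t \<in> nodes K. forces K t A)"

text \<open>
  A node of the tree is represented by the sequence of extension steps leading to it from the
  root, most recent step first. Thus the root is the empty list, the direct successors of
  \<open>t\<close> are the lists \<open>s # t\<close> with \<open>s\<close> admissible at \<open>t\<close>, and the tree order is the suffix order.
  Nodes reached by different sequences of steps are distinct, even if their labels coincide.
\<close>

datatype step = AddTerm nde | AddEqn eqn

type_synonym node = "step list"

primrec M_inf :: "node \<Rightarrow> nde set" where
  "M_inf [] = {Zero}"
| "M_inf (s # t) = (case s of AddTerm z \<Rightarrow> M_inf t \<union> {z} | AddEqn p \<Rightarrow> M_inf t)"

primrec E_inf :: "node \<Rightarrow> eqn set" where
  "E_inf [] = {}"
| "E_inf (s # t) = (case s of AddTerm z \<Rightarrow> E_inf t | AddEqn p \<Rightarrow> E_inf t \<union> {p})"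

definition steps :: "node \<Rightarrow> step set" where
  "steps t =
     {AddTerm z | z x y. x \<in> M_inf t \<and> y \<in> M_inf t \<and> z \<in> {Succ x, Plus x y, Times x y} \<and> z \<notin> M_inf t}
     \<union> {AddEqn (Eqn x y) | x y.
          x \<in> M_inf t \<and> y \<in> M_inf t \<and> denote x = denote y \<and> Eqn x y \<notin> E_inf t}"

inductive_set T_inf :: "node set" where
  root: "[] \<in> T_inf"
| succ: "t \<in> T_inf \<Longrightarrow> s \<in> steps t \<Longrightarrow> s # t \<in> T_inf"

definition S_inf :: "node tree_structure" where
  "S_inf = \<lparr>nodes = T_inf, le = suffix, M = M_inf, E = E_inf\<rparr>"

lemma finite_M_inf: "finite (M_inf t)"
  by (induction t) (auto split: step.split)

lemma Zero_in_M_inf: "Zero \<in> M_inf t"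
  by (induction t) (auto split: step.split)

lemma finite_steps: "finite (steps t)"
proof (rule finite_subset)
  let ?M = "M_inf t"
  show "steps t \<subseteq> AddTerm ` (Succ ` ?M \<union> case_prod Plus ` (?M \<times> ?M) \<union> case_prod Times ` (?M \<times> ?M))
      \<union> (AddEqn \<circ> case_prod Eqn) ` (?M \<times> ?M)"
    by (force simp: steps_def)
qed (simp add: finite_M_inf)

lemma steps_nonempty: "steps t \<noteq> {}"
proof -
  have "Max (size ` M_inf t) \<in> size ` M_inf t"
    using finite_M_inf[of t] Zero_in_M_inf[of t] by (intro Max_in) auto
  then obtain x where x: "x \<in> M_inf t" "size x = Max (size ` M_inf t)"
    by auto
  have "Succ x \<notin> M_inf t"
  proof
    assume "Succ x \<in> M_inf t"
    then have "size (Succ x) \<le> Max (size ` M_inf t)"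
      by (intro Max_ge imageI finite_imageI finite_M_inf)
    with x(2) show False by simp
  qed
  with x(1) have "AddTerm (Succ x) \<in> steps t"
    unfolding steps_def by blast
  then show ?thesis by blast
qed

lemma T_inf_suffix_closed: "t \<in> T_inf \<Longrightarrow> suffix u t \<Longrightarrow> u \<in> T_inf"
  by (induction rule: T_inf.induct) (auto simp: suffix_Cons intro: T_inf.intros)

end

theory Submission
  imports Defs
begin

text \<open>An implication only asks that its conclusion be forced at some later node, so it cannot
  tell a formula that holds now from one that can always still be reached. The equation 0 = 0
  separates the two: the root does not force it, yet by \<open>exists_extension_Zero_eq_Zero\<close>
  every node has an extension that does. Hence the root forces neither it nor its negation, and
  modus ponens fails from any valid premise, such as \<open>Imp Bot Bot\<close>, to this
  equation.\<close>

lemma valid_S_inf: "valid S_inf A \<longleftrightarrow> (\<forall>t \<in> T_inf. forces S_inf t A)"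
  by (simp add: valid_def S_inf_def)

lemma forces_S_inf_Atom: "forces S_inf t (Atom p) \<longleftrightarrow> p \<in> E_inf t"
  by (simp add: S_inf_def)

lemma forces_S_inf_Imp:
  "forces S_inf t (Imp A B) \<longleftrightarrow>
     (\<forall>t' \<in> T_inf. suffix t t' \<and> forces S_inf t' A \<longrightarrow>
        (\<exists>t'' \<in> T_inf. suffix t' t'' \<and> forces S_inf t'' B))"
  by (simp add: S_inf_def)

text \<open>Since \<open>Zero\<close> lies in every \<open>M_inf t\<close>, adding the equation is
  an admissible step as long as it is absent.\<close>

lemma exists_extension_Zero_eq_Zero:
  assumes "t \<in> T_inf"
  shows "\<exists>t' \<in> T_inf. suffix t t' \<and> Eqn Zero Zero \<in> E_inf t'"
proof (cases "Eqn Zero Zero \<in> E_inf t")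
  case True
  with assms show ?thesis by blast
next
  case False
  then have "AddEqn (Eqn Zero Zero) \<in> steps t"
    by (auto simp: steps_def Zero_in_M_inf)
  with assms have "AddEqn (Eqn Zero Zero) # t \<in> T_inf"
    by (rule T_inf.succ)
  then show ?thesis
    by (rule bexI[rotated]) (simp add: suffix_ConsI)
qed

theorem proposition6:
  shows "(\<exists>A. \<not> valid S_inf (Disj A (Neg A))) \<and>
         (\<exists>A B. valid S_inf (Imp B A) \<and> valid S_inf B \<and> \<not> valid S_inf A)"
proof -
  let ?A = "Atom (Eqn Zero Zero)" and ?B = "Imp Bot Bot"
  have root: "\<not> forces S_inf [] ?A"
    by (simp add: S_inf_def)
  have dense: "\<exists>t' \<in> T_inf. suffix t t' \<and> forces S_inf t' ?A" if "t \<in> T_inf" for t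
    using exists_extension_Zero_eq_Zero[OF that] by (simp only: forces_S_inf_Atom)
  \<comment> \<open>A node above the root forcing \<open>?A\<close> would need an extension forcing
    \<open>Bot\<close>.\<close>
  have "\<not> forces S_inf [] (Neg ?A)"
    using dense[OF T_inf.root] unfolding forces_S_inf_Imp by auto
  with root have "\<not> valid S_inf (Disj ?A (Neg ?A))"
    unfolding valid_S_inf forces.simps(4) using T_inf.root by blast
  \<comment> \<open>Density supplies, above each node forcing \<open>?B\<close>, the later node
    forcing \<open>?A\<close>.\<close>
  moreover have "valid S_inf (Imp ?B ?A)"
    unfolding valid_S_inf forces_S_inf_Imp[of _ ?B ?A] using dense by blast
  moreover have "valid S_inf ?B"
    by (simp add: valid_def)
  moreover have "\<not> valid S_inf ?A"
    unfolding valid_S_inf using root T_inf.root by blast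
  ultimately show ?thesis by blast
qed

end
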